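(* Let $u=abcacbc$, where $a,b,c$ are distinct letters. Then $\operatorname{Sat}(n,u)=O(n)$ as $n\to\infty$.
   Context: Let $r$ be the number of distinct letters of a finite sequence $u$ (here $r=3$). Two sequences are isomorphic if one is obtained from the other by a one-to-one renaming of letters. A copy of $u$ in a sequence $s$ is a (not necessarily contiguous) subsequence of $s$ isomorphic to $u$; $s$ avoids $u$ if it contains no copy of $u$. A sequence is $r$-sparse if any $r$ consecutive letters in it are pairwise distinct. A finite sequence $s$ with letters in an alphabet $A$ is $u$-saturated if $s$ is $r$-sparse, $s$ avoids $u$, and inserting any letter of $A$ at any position of $s$ (including the beginning and the end) yields a sequence that is not $r$-sparse or that contains a copy of $u$. $\operatorname{Sat}(n,u)$ is the minimum length of a $u$-saturated sequence over an alphabet of $n$ letters. *)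

theory Defs
  imports "HOL-Library.Sublist" "HOL-Library.Landau_Symbols"
begin

definition isomorphic_seq :: "'a list \<Rightarrow> 'b list \<Rightarrow> bool" where
  "isomorphic_seq u v \<longleftrightarrow> (\<exists>f. inj_on f (set u) \<and> v = map f u)"

definition contains_copy :: "'b list \<Rightarrow> 'a list \<Rightarrow> bool" where
  "contains_copy s u \<longleftrightarrow> (\<exists>v. subseq v s \<and> isomorphic_seq u v)"

definition avoids :: "'b list \<Rightarrow> 'a list \<Rightarrow> bool" where
  "avoids s u \<longleftrightarrow> \<not> contains_copy s u"

text \<open>
  Blocks shorter than \<open>r\<close> are included so that a sequence of length less than \<open>r\<close> is
  \<open>r\<close>-sparse only if its letters are distinct; for sequences of length at least \<open>r\<close> this
  makes no difference. If only blocks of length exactly \<open>r\<close> were considered, the sequence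
  \<open>aa\<close> would be vacuously 3-sparse, and saturated because no insertion into it is 3-sparse.
\<close>

definition sparse :: "nat \<Rightarrow> 'a list \<Rightarrow> bool" where
  "sparse r s \<longleftrightarrow> (\<forall>xs ys zs. s = xs @ ys @ zs \<and> length ys \<le> r \<longrightarrow> distinct ys)"

definition saturated :: "'b set \<Rightarrow> 'a list \<Rightarrow> 'b list \<Rightarrow> bool" where
  "saturated A u s \<longleftrightarrow>
     set s \<subseteq> A \<and> sparse (card (set u)) s \<and> avoids s u \<and>
     (\<forall>x\<in>A. \<forall>xs ys. s = xs @ ys \<longrightarrow>
        \<not> sparse (card (set u)) (xs @ x # ys) \<or> contains_copy (xs @ x # ys) u)"

text \<open>
  The minimum is attained for every nonempty \<open>u\<close>, by \<open>saturated_exists\<close> below.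
\<close>

definition Sat :: "nat \<Rightarrow> 'a list \<Rightarrow> nat" where
  "Sat n u = (LEAST k. \<exists>A :: nat set. \<exists>s.
     finite A \<and> card A = n \<and> saturated A u s \<and> length s = k)"

lemma subseq_concat_repeated:
  assumes "length w \<le> count_list bs b" and "set w \<subseteq> set b"
  shows "subseq w (concat bs)"
  using assms
proof (induction bs arbitrary: w)
  case Nil
  then show ?case by simp
next
  case (Cons b' bs)
  show ?case
  proof (cases "b' = b \<and> w \<noteq> []")
    case True
    then obtain x w' where w: "w = x # w'" by (cases w) auto
    have "subseq w' (concat bs)"
      using Cons True w by auto
    moreover have "subseq [x] b"
      using Cons.prems w by (simp add: subseq_singleton_left)
    ultimately have "subseq ([x] @ w') (b @ concat bs)"
      by (rule list_emb_append_mono[rotated])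
    then show ?thesis using True w by simp
  next
    case False
    then have "length w \<le> count_list bs b"
      using Cons.prems by (cases "w = []") auto
    then have "subseq w (concat bs)" using Cons by blast
    then show ?thesis by (simp add: list_emb_append2)
  qed
qed

lemma split_into_blocks:
  assumes "M * r \<le> length s"
  shows "\<exists>bs zs. s = concat bs @ zs \<and> length bs = M \<and> (\<forall>b\<in>set bs. length b = r)"
  using assms
proof (induction M arbitrary: s)
  case 0
  then show ?case by simp
next
  case (Suc M)
  then have "M * r \<le> length (drop r s)" by simp
  then obtain bs zs where bs: "drop r s = concat bs @ zs" "length bs = M"
    "\<forall>b\<in>set bs. length b = r"
    using Suc.IH by blast
  have "s = concat (take r s # bs) @ zs"
    using bs(1) append_take_drop_id[of r s] by simp
  moreover have "length (take r s) = r" using Suc.prems by simp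
  ultimately show ?case using bs
    by (intro exI[of _ "take r s # bs"] exI[of _ zs]) auto
qed

lemma sparse_avoids_length_less:
  assumes "finite A" and "set s \<subseteq> A" and "sparse (card (set u)) s" and "avoids s u"
  shows "length s < Suc (card A ^ card (set u) * length u) * card (set u)"
proof (rule ccontr)
  define r where "r = card (set u)"
  define X where "X = {b. set b \<subseteq> A \<and> length b = r}"
  have X: "finite X" "card X = card A ^ r"
    unfolding X_def using assms(1) by (simp_all add: finite_lists_length_eq card_lists_length_eq)
  assume "\<not> ?thesis"
  then have "Suc (card X * length u) * r \<le> length s" by (simp add: X r_def)
  from split_into_blocks[OF this] obtain bs zs where bs: "s = concat bs @ zs"
    "length bs = Suc (card X * length u)" "\<forall>b\<in>set bs. length b = r"
    by blast
  have "set bs \<subseteq> X" using bs assms(2) by (auto simp: X_def)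
  then have *: "sum (count_list bs) X = Suc (card X * length u)"
    using X(1) bs(2) by (simp add: sum_count_set)
  have "\<exists>b\<in>X. length u < count_list bs b"
  proof (rule ccontr)
    assume "\<not> (\<exists>b\<in>X. length u < count_list bs b)"
    then have "\<And>b. b \<in> X \<Longrightarrow> count_list bs b \<le> length u" by (meson not_less)
    then have "sum (count_list bs) X \<le> of_nat (card X) * length u" by (rule sum_bounded_above)
    with * show False by simp
  qed
  then obtain b where b: "b \<in> X" "length u < count_list bs b" by blast
  then have "b \<in> set bs" by (metis count_notin not_less_zero)
  then obtain p q where "bs = p @ b # q" by (meson split_list)
  then have "s = concat p @ b @ (concat q @ zs)" using bs(1) by simp
  moreover have "length b = r" using b(1) by (simp add: X_def)
  ultimately have "distinct b"
    using assms(3)[unfolded sparse_def, rule_format, of "concat p" b "concat q @ zs"]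
    by (simp add: r_def)
  then have "card (set b) = card (set u)"
    using \<open>length b = r\<close> by (simp add: distinct_card r_def)
  then obtain f where f: "bij_betw f (set u) (set b)"
    by (metis List.finite_set finite_same_card_bij)
  have "subseq (map f u) (concat bs)"
    using b(2) f by (intro subseq_concat_repeated[of _ _ b]) (auto simp: bij_betw_def)
  then have "subseq (map f u) s" using bs(1) by (simp add: list_emb_prefix)
  then have "contains_copy s u"
    using f unfolding contains_copy_def isomorphic_seq_def bij_betw_def by blast
  then show False using assms(4) by (simp add: avoids_def)
qed

lemma saturated_exists:
  assumes "finite A" and "u \<noteq> []"
  shows "\<exists>s. saturated A u s"
proof -
  define P where "P s \<longleftrightarrow> set s \<subseteq> A \<and> sparse (card (set u)) s \<and> avoids s u" for s
  have "P []"
    using assms(2) by (auto simp: P_def sparse_def avoids_def contains_copy_def isomorphic_seq_def)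
  moreover have "\<forall>s. P s \<longrightarrow> length s < Suc (card A ^ card (set u) * length u) * card (set u)"
    using sparse_avoids_length_less[OF assms(1)] by (auto simp: P_def)
  ultimately obtain s where s: "P s" "\<And>t. P t \<Longrightarrow> length t \<le> length s"
    using ex_has_greatest_nat[of P "[]" length] by blast
  have "\<not> sparse (card (set u)) (xs @ x # ys) \<or> contains_copy (xs @ x # ys) u"
    if "x \<in> A" "s = xs @ ys" for x xs ys
  proof -
    have "\<not> P (xs @ x # ys)"
      using s(2)[of "xs @ x # ys"] that(2) by auto
    moreover have "set (xs @ x # ys) \<subseteq> A"
      using s(1) that by (simp add: P_def)
    ultimately show ?thesis by (simp add: P_def avoids_def)
  qed
  then have "saturated A u s"
    using s(1) by (simp add: saturated_def P_def)
  then show ?thesis ..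
qed

end

theory Submission imports Defs begin

text \<open>
  A saturated sequence of length \<open>O(n)\<close> is obtained by growing a rigid seed: a 3-sparse word \<open>t\<close> of
  length \<open>O(n)\<close> that avoids \<open>u\<close> and into which, at every gap, all but at most eight letters
  can be inserted only at the price of a copy of \<open>u\<close>. Any 3-sparse \<open>u\<close>-avoiding
  supersequence of \<open>t\<close> then has, at each of the \<open>O(n)\<close> gaps of \<open>t\<close>, a word over at most eight letters,
  whose length is bounded because it is itself 3-sparse and avoids \<open>u\<close>. So a longest such
  supersequence has length \<open>O(n)\<close>, and being longest it is saturated (\<open>saturated_from_seed\<close>).

  The seed uses five special letters 0, ..., 4 and \<open>2m\<close> generic letters, grouped into the pairs
  \<open>{2j + 5, 2j + 6}\<close> for \<open>j < m\<close>. With \<open>0, 1, 2, 3, 4\<close> written as \<open>r, p, q, e, f\<close> and with generic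
  letters \<open>g\<^sub>1, ..., g\<^sub>k\<close>, where \<open>k = 2m\<close>, it is

  \<open>r p q e p r | g\<^sub>1 g\<^sub>2 p g\<^sub>3 g\<^sub>4 p ... g\<^sub>k p | q g\<^sub>k ... g\<^sub>4 g\<^sub>3 q g\<^sub>2 g\<^sub>1 q | e f r e\<close>.

  The generic letters run upwards, separated by \<open>p\<close>, and then downwards, separated by \<open>q\<close>. The core
  of the construction is that for a generic letter \<open>x\<close> this gives \<open>p q ... x p ... q x q\<close>, and a third
  \<open>x\<close> completes this to a copy of the form \<open>p q x p x q x\<close>, whether it stands before, between or
  after the two that are there, as long as it comes after the initial \<open>p q\<close> and is not too close to an
  old \<open>x\<close>. The remaining letters of the first and last part take care of the
  gaps in front of \<open>q\<close>: they give the copies \<open>r x p r p x p\<close> and, at the very beginning,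
  \<open>x r e x e r e\<close> (\<open>seed_insertion\<close>). The downward order in the second half keeps the seed itself
  free of copies (\<open>avoids_seed\<close>): with both halves upward, \<open>g\<^sub>1 g\<^sub>3 q g\<^sub>1 q g\<^sub>3 q\<close> would be a copy.
\<close>

section \<open>Saturated sequences grown from a rigid seed\<close>

lemma sparse_factor:
  assumes "sparse r (xs @ w @ zs)"
  shows "sparse r w"
  unfolding sparse_def
proof (intro allI impI, elim conjE)
  fix as bs cs
  assume "w = as @ bs @ cs" "length bs \<le> r"
  then have "xs @ w @ zs = (xs @ as) @ bs @ (cs @ zs)" by simp
  with assms \<open>length bs \<le> r\<close> show "distinct bs" unfolding sparse_def by blast
qed

lemma contains_copy_mono:
  assumes "contains_copy s u" and "subseq s t"
  shows "contains_copy t u"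
  using assms unfolding contains_copy_def by (meson subseq_order.order_trans)

text \<open>
  An embedding of \<open>t\<close> into \<open>s\<close> cuts the rest of \<open>s\<close> into \<open>length t + 1\<close> words, one per gap of \<open>t\<close>.
\<close>

lemma length_le_by_gaps:
  assumes "subseq t s"
    and "\<And>p w q t1 t2. s = p @ w @ q \<Longrightarrow> t = t1 @ t2 \<Longrightarrow> subseq t1 p \<Longrightarrow> subseq t2 q \<Longrightarrow>
      length w \<le> C"
  shows "length s \<le> length t + Suc (length t) * C"
  using assms
proof (induction t arbitrary: s)
  case Nil
  have "length s \<le> C" using Nil.prems(2)[of "[]" s "[]" "[]" "[]"] by simp
  then show ?case by simp
next
  case (Cons x t)
  obtain w s' where s: "s = w @ x # s'" and t: "subseq t s'"
    using list_emb_ConsD[OF Cons.prems(1)] by auto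
  have w: "length w \<le> C"
    using Cons.prems(2)[of "[]" w "x # s'" "[]" "x # t"] s t by simp
  have "length s' \<le> length t + Suc (length t) * C"
  proof (rule Cons.IH[OF t])
    fix p v q t1 t2
    assume *: "s' = p @ v @ q" "t = t1 @ t2" "subseq t1 p" "subseq t2 q"
    have "subseq (x # t1) (w @ x # p)"
      using *(3) by (intro list_emb_append2) simp
    then show "length v \<le> C"
      using Cons.prems(2)[of "w @ x # p" v q "x # t1" t2] s * by simp
  qed
  with w s show ?case by simp
qed

text \<open>
  A longest sparse \<open>u\<close>-avoiding supersequence of the seed \<open>t\<close> is saturated, since an insertion
  gives a longer supersequence. It cannot be long: a letter standing in it at a gap of \<open>t\<close> may be
  inserted there alone without a copy of \<open>u\<close>, so the whole word at that gap uses at most \<open>k\<close> letters,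
  and sparse \<open>u\<close>-avoiding words over \<open>k\<close> letters have bounded length.
\<close>

lemma saturated_from_seed:
  assumes "finite A" and tA: "set t \<subseteq> A"
    and sp: "sparse (card (set u)) t" and av: "avoids t u"
    and gap: "\<And>xs ys. t = xs @ ys \<Longrightarrow> card {x \<in> A. \<not> contains_copy (xs @ x # ys) u} \<le> k"
  shows "\<exists>s. saturated A u s \<and> length s \<le>
    length t + Suc (length t) * (Suc (k ^ card (set u) * length u) * card (set u))"
proof -
  define P where "P s \<longleftrightarrow> set s \<subseteq> A \<and> sparse (card (set u)) s \<and> avoids s u \<and> subseq t s" for s
  have "P t" using assms by (simp add: P_def)
  moreover have "\<forall>s. P s \<longrightarrow> length s < Suc (card A ^ card (set u) * length u) * card (set u)"
    using sparse_avoids_length_less[OF assms(1)] by (auto simp: P_def)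
  ultimately obtain s where s: "P s" and max: "\<And>s'. P s' \<Longrightarrow> length s' \<le> length s"
    using ex_has_greatest_nat[of P t length] by blast
  have "\<not> sparse (card (set u)) (xs @ x # ys) \<or> contains_copy (xs @ x # ys) u"
    if "x \<in> A" "s = xs @ ys" for x xs ys
  proof -
    have "\<not> P (xs @ x # ys)" using max[of "xs @ x # ys"] that(2) by auto
    moreover have "set (xs @ x # ys) \<subseteq> A" using s that by (simp add: P_def)
    moreover have "subseq s (xs @ x # ys)"
      unfolding that(2) by (intro list_emb_append_mono list_emb_Cons) auto
    then have "subseq t (xs @ x # ys)" using s unfolding P_def by (meson subseq_order.order_trans)
    ultimately show ?thesis by (simp add: P_def avoids_def)
  qed
  then have "saturated A u s" using s by (simp add: saturated_def P_def)
  moreover have "length s \<le>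
    length t + Suc (length t) * (Suc (k ^ card (set u) * length u) * card (set u))"
  proof (rule length_le_by_gaps)
    show "subseq t s" using s by (simp add: P_def)
  next
    fix p w q t1 t2
    assume *: "s = p @ w @ q" "t = t1 @ t2" "subseq t1 p" "subseq t2 q"
    define K where "K = {x \<in> A. \<not> contains_copy (t1 @ x # t2) u}"
    have "set w \<subseteq> K"
    proof
      fix x assume "x \<in> set w"
      then have "subseq [x] w" by (simp add: subseq_singleton_left)
      then have "subseq (t1 @ [x] @ t2) s"
        unfolding *(1) using *(3,4) by (intro list_emb_append_mono)
      then have "\<not> contains_copy (t1 @ x # t2) u"
        using s contains_copy_mono[of "t1 @ x # t2" u s] by (auto simp: P_def avoids_def)
      moreover have "x \<in> A" using \<open>x \<in> set w\<close> s *(1) by (auto simp: P_def)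
      ultimately show "x \<in> K" by (simp add: K_def)
    qed
    moreover have "sparse (card (set u)) w"
      using s *(1) sparse_factor by (auto simp: P_def)
    moreover have "subseq w s"
      unfolding *(1) by (simp add: list_emb_append2 list_emb_prefix)
    then have "avoids w u"
      using s contains_copy_mono by (auto simp: P_def avoids_def)
    moreover have "finite K" using assms(1) by (simp add: K_def)
    ultimately have "length w < Suc (card K ^ card (set u) * length u) * card (set u)"
      by (intro sparse_avoids_length_less)
    also have "\<dots> \<le> Suc (k ^ card (set u) * length u) * card (set u)"
      using gap[OF *(2)] by (intro mult_le_mono1 Suc_le_mono[THEN iffD2] power_mono) (auto simp: K_def)
    finally show "length w \<le> Suc (k ^ card (set u) * length u) * card (set u)" by simp
  qed
  ultimately show ?thesis by blast
qed

section \<open>Copies of the pattern and 3-sparseness\<close>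

definition has_abcacbc :: "'b list \<Rightarrow> bool" where
  "has_abcacbc s \<longleftrightarrow> (\<exists>x y z. distinct [x, y, z] \<and> subseq [x, y, z, x, z, y, z] s)"

lemma contains_copy_abcacbc_iff:
  assumes "distinct [a, b, c]"
  shows "contains_copy s [a, b, c, a, c, b, c] \<longleftrightarrow> has_abcacbc s"
  unfolding has_abcacbc_def
proof
  assume "contains_copy s [a, b, c, a, c, b, c]"
  then obtain f where "inj_on f {a, b, c}" "subseq (map f [a, b, c, a, c, b, c]) s"
    unfolding contains_copy_def isomorphic_seq_def by (auto simp: insert_commute)
  then show "\<exists>x y z. distinct [x, y, z] \<and> subseq [x, y, z, x, z, y, z] s"
    using assms by (intro exI[of _ "f a"] exI[of _ "f b"] exI[of _ "f c"]) (auto simp: inj_on_def)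
next
  assume "\<exists>x y z. distinct [x, y, z] \<and> subseq [x, y, z, x, z, y, z] s"
  then obtain x y z where *: "distinct [x, y, z]" "subseq [x, y, z, x, z, y, z] s" by blast
  define f where "f l = (if l = a then x else if l = b then y else z)" for l
  have "inj_on f (set [a, b, c, a, c, b, c])"
    using assms * by (auto simp: inj_on_def f_def)
  moreover have "map f [a, b, c, a, c, b, c] = [x, y, z, x, z, y, z]"
    using assms by (auto simp: f_def)
  ultimately show "contains_copy s [a, b, c, a, c, b, c]"
    using *(2) unfolding contains_copy_def isomorphic_seq_def by metis
qed

lemma sparse_Nil: "sparse r []"
  by (simp add: sparse_def)

lemma sparse_Cons:
  assumes "x \<notin> set (take r xs)" and "sparse (Suc r) xs"
  shows "sparse (Suc r) (x # xs)"
  unfolding sparse_def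
proof (intro allI impI, elim conjE)
  fix as bs cs
  assume *: "x # xs = as @ bs @ cs" "length bs \<le> Suc r"
  show "distinct bs"
  proof (cases as)
    case (Cons _ as')
    then have "xs = as' @ bs @ cs" using * by simp
    with assms(2) *(2) show ?thesis unfolding sparse_def by blast
  next
    case Nil
    show ?thesis
    proof (cases bs)
      case (Cons _ bs')
      then have **: "bs = x # bs'" "xs = [] @ bs' @ cs" "length bs' \<le> r" using Nil * by auto
      then have "distinct bs'" using assms(2) unfolding sparse_def by (metis le_SucI)
      moreover have "x \<notin> set bs'" using ** assms(1) by auto
      ultimately show ?thesis using ** by simp
    qed simp
  qed
qed

section \<open>The seed\<close>

definition up_block :: "nat \<Rightarrow> nat list" where
  "up_block i = [2 * i + 5, 2 * i + 6, 1]"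

definition down_block :: "nat \<Rightarrow> nat list" where
  "down_block i = [2 * i + 6, 2 * i + 5, 2]"

definition up_part :: "nat \<Rightarrow> nat list" where
  "up_part m = concat (map up_block [0..<m])"

definition down_part :: "nat \<Rightarrow> nat list" where
  "down_part m = 2 # concat (map down_block (rev [0..<m]))"

text \<open>
  The 4 keeps 3-sparseness between the 3 and the 0 of the last part. It occurs only once, hence in no
  copy. Separating pairs rather than single generic letters likewise serves 3-sparseness.
\<close>

definition seed :: "nat \<Rightarrow> nat list" where
  "seed m = [0, 1, 2, 3, 1, 0] @ up_part m @ down_part m @ [3, 4, 0, 3]"

lemma set_up_part: "set (up_part m) \<subseteq> insert 1 {5..<2 * m + 5}"
  by (auto simp: up_part_def up_block_def)

lemma set_down_part: "set (down_part m) \<subseteq> insert 2 {5..<2 * m + 5}"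
  by (auto simp: down_part_def down_block_def)

lemma length_seed: "length (seed m) = 6 * m + 11"
  by (simp add: seed_def up_part_def down_part_def length_concat comp_def up_block_def
      down_block_def sum_list_triv flip: rev_map)

lemma sparse_3_Cons:
  assumes "sparse 3 (y # z # zs)" and "x \<noteq> y" and "x \<noteq> z"
  shows "sparse 3 (x # y # z # zs)"
  using sparse_Cons[of x 2 "y # z # zs"] assms by (simp add: numeral_2_eq_2 numeral_3_eq_3)

text \<open>
  In the next two lemmas, the conditions on the first two letters of the rest keep the
  induction over the blocks going: they let a block end in front of the rest, and they hold again for
  the lengthened rest.
\<close>

lemma sparse_up_blocks:
  assumes "sparse 3 (y # z # zs)" and "y \<notin> {0, 1}" and "z \<notin> {0, 1}" and "odd y \<or> y < 6"
  shows "\<exists>y' z' zs'. concat (map up_block is) @ y # z # zs = y' # z' # zs' \<and>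
    sparse 3 (y' # z' # zs') \<and> y' \<notin> {0, 1} \<and> z' \<notin> {0, 1} \<and> (odd y' \<or> y' < 6)"
proof (induction "is")
  case Nil
  then show ?case using assms by simp
next
  case (Cons i "is")
  then obtain y' z' zs' where eq: "concat (map up_block is) @ y # z # zs = y' # z' # zs'"
    and sp: "sparse 3 (y' # z' # zs')" and *: "y' \<notin> {0, 1}" "z' \<notin> {0, 1}" "odd y' \<or> y' < 6"
    by blast
  have "sparse 3 (1 # y' # z' # zs')"
    by (rule sparse_3_Cons[OF sp]) (use * in auto)
  then have "sparse 3 ((2 * i + 6) # 1 # y' # z' # zs')"
    by (rule sparse_3_Cons) (use * in auto)
  then have "sparse 3 ((2 * i + 5) # (2 * i + 6) # 1 # y' # z' # zs')"
    by (rule sparse_3_Cons) auto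
  then show ?case by (simp add: eq up_block_def[of i])
qed

lemma sparse_down_blocks:
  assumes "sparse 3 (y # z # zs)" and "y \<notin> {0, 1, 2}" and "z \<notin> {1, 2}" and "even y \<or> y < 5"
  shows "\<exists>y' z' zs'. concat (map down_block is) @ y # z # zs = y' # z' # zs' \<and>
    sparse 3 (y' # z' # zs') \<and> y' \<notin> {0, 1, 2} \<and> z' \<notin> {1, 2} \<and> (even y' \<or> y' < 5)"
proof (induction "is")
  case Nil
  then show ?case using assms by simp
next
  case (Cons i "is")
  then obtain y' z' zs' where eq: "concat (map down_block is) @ y # z # zs = y' # z' # zs'"
    and sp: "sparse 3 (y' # z' # zs')" and *: "y' \<notin> {0, 1, 2}" "z' \<notin> {1, 2}" "even y' \<or> y' < 5"
    by blast
  have "sparse 3 (2 # y' # z' # zs')"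
    by (rule sparse_3_Cons[OF sp]) (use * in auto)
  then have "sparse 3 ((2 * i + 5) # 2 # y' # z' # zs')"
    by (rule sparse_3_Cons) (use * in auto)
  then have "sparse 3 ((2 * i + 6) # (2 * i + 5) # 2 # y' # z' # zs')"
    by (rule sparse_3_Cons) auto
  then show ?case by (simp add: eq down_block_def[of i])
qed

lemma sparse_seed: "sparse 3 (seed m)"
proof -
  have "sparse 3 [0::nat, 3]"
    unfolding numeral_3_eq_3 by (intro sparse_Cons sparse_Nil) auto
  then have "sparse 3 [3::nat, 4, 0, 3]"
    by (intro sparse_3_Cons) auto
  from sparse_down_blocks[OF this, of "rev [0..<m]"]
  obtain y z zs where down: "down_part m @ [3, 4, 0, 3] = 2 # y # z # zs"
    "sparse 3 (y # z # zs)" "y \<notin> {0, 1, 2}" "z \<notin> {1, 2}"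
    by (auto simp: down_part_def)
  then have "sparse 3 (2 # y # z # zs)" by (intro sparse_3_Cons) auto
  from sparse_up_blocks[OF this, of "[0..<m]"] down
  obtain y' z' zs' where up: "up_part m @ down_part m @ [3, 4, 0, 3] = y' # z' # zs'"
    "sparse 3 (y' # z' # zs')" "y' \<notin> {0, 1}" "z' \<notin> {0, 1}"
    by (auto simp: up_part_def)
  then show ?thesis
    unfolding seed_def up(1) append_Cons append_Nil
    by (intro sparse_3_Cons) auto
qed

section \<open>The seed avoids the pattern\<close>

lemma subseq_in_set:
  assumes "subseq v s" and "x \<in> set v"
  shows "x \<in> set s"
  using assms by (induction rule: list_emb.induct) auto

lemma subseq_snoc_append_notin:
  assumes "subseq (v @ [z]) (s @ t)" and "z \<notin> set t"
  shows "subseq (v @ [z]) s"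
proof -
  obtain v1 v2 where *: "v @ [z] = v1 @ v2" "subseq v1 s" "subseq v2 t"
    using assms(1) unfolding subseq_append_iff by blast
  have "v2 = []"
  proof (rule ccontr)
    assume "v2 \<noteq> []"
    then have "z \<in> set v2" using *(1) by (metis last_appendR last_in_set last_snoc)
    with *(3) assms(2) show False by (blast dest: subseq_in_set)
  qed
  with * show ?thesis by simp
qed

lemma subseq_Cons_append_notin:
  assumes "subseq (z # v) (s @ t)" and "z \<notin> set s"
  shows "subseq (z # v) t"
  using assms by (induction s) auto

lemma count_le_subseq:
  assumes "subseq v s"
  shows "count_list v x \<le> count_list s x"
  using assms by (induction rule: list_emb.induct) auto

text \<open>
  Mirror words avoid \<open>abab\<close>: by induction, the outermost letter of the mirror word can play
  neither role.
\<close>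

lemma not_subseq_abab_mirror:
  assumes "distinct w" and "x \<noteq> y"
  shows "\<not> subseq [x, y, x, y] (w @ rev w)"
  using assms(1)
proof (induction w)
  case (Cons a w)
  have eq: "(a # w) @ rev (a # w) = a # (w @ rev w) @ [a]" by simp
  show ?case
  proof
    assume sub: "subseq [x, y, x, y] ((a # w) @ rev (a # w))"
    have a: "a \<notin> set (w @ rev w)" using Cons.prems by auto
    show False
    proof (cases "x = a")
      case True
      then have "subseq ([y, x] @ [y]) ((w @ rev w) @ [a])" using sub unfolding eq by simp
      then have "subseq ([y, x] @ [y]) (w @ rev w)"
        by (rule subseq_snoc_append_notin) (use True assms(2) in auto)
      then have "x \<in> set (w @ rev w)" by (rule subseq_in_set) simp
      with a True show False by simp
    next
      case False
      then have *: "subseq ([x, y, x] @ [y]) ((w @ rev w) @ [a])" using sub unfolding eq by simp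
      show False
      proof (cases "y = a")
        case True
        have "subseq ([x, y] @ [x]) ((w @ rev w) @ [a])"
          using * by (rule subseq_order.order_trans[rotated]) simp
        then have "subseq ([x, y] @ [x]) (w @ rev w)"
          by (rule subseq_snoc_append_notin) (use False in auto)
        then have "y \<in> set (w @ rev w)" by (rule subseq_in_set) simp
        with a True show False by simp
      next
        case False
        have "subseq ([x, y, x] @ [y]) (w @ rev w)"
          using * by (rule subseq_snoc_append_notin) (use False in auto)
        then show False using Cons by simp
      qed
    qed
  qed
qed simp

lemma upt_two_more: "[5..<2 * Suc m + 5] = [5..<2 * m + 5] @ [2 * m + 5, 2 * m + 6]"
proof -
  have "[5..<Suc (Suc k)] = [5..<k] @ [k, Suc k]" if "5 \<le> k" for k
    using that by simp
  from this[of "2 * m + 5"] show ?thesis by (simp del: upt_Suc)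
qed

lemma filter_ge_5_up_part: "filter (\<lambda>x. 5 \<le> x) (up_part m) = [5..<2 * m + 5]"
proof (induction m)
  case (Suc m)
  then show ?case unfolding upt_two_more by (simp add: up_part_def up_block_def)
qed (simp add: up_part_def)

lemma filter_ge_5_down_part: "filter (\<lambda>x. 5 \<le> x) (down_part m) = rev [5..<2 * m + 5]"
proof (induction m)
  case (Suc m)
  then show ?case unfolding upt_two_more by (simp add: down_part_def down_block_def)
qed (simp add: down_part_def)

lemma filter_ge_5_seed:
  "filter (\<lambda>x. 5 \<le> x) (seed m) = [5..<2 * m + 5] @ rev [5..<2 * m + 5]"
  by (simp add: seed_def filter_ge_5_up_part filter_ge_5_down_part)

lemma count_list_distinct_le_1: "distinct xs \<Longrightarrow> count_list xs x \<le> 1"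
  by (induction xs) auto

lemma count_list_filter: "P x \<Longrightarrow> count_list (filter P xs) x = count_list xs x"
  by (induction xs) auto

lemma count_generic:
  assumes "5 \<le> x"
  shows "count_list (up_part m) x \<le> 1" and "count_list (down_part m) x \<le> 1"
proof -
  have "count_list (filter (\<lambda>x. 5 \<le> x) (up_part m)) x \<le> 1"
    unfolding filter_ge_5_up_part by (rule count_list_distinct_le_1) simp
  then show "count_list (up_part m) x \<le> 1" using assms by (simp add: count_list_filter)
  have "count_list (filter (\<lambda>x. 5 \<le> x) (down_part m)) x \<le> 1"
    unfolding filter_ge_5_down_part by (rule count_list_distinct_le_1) simp
  then show "count_list (down_part m) x \<le> 1" using assms by (simp add: count_list_filter)
qed


text \<open>
  The letter \<open>z\<close> of a copy \<open>xyzxzyz\<close> occurs three times, so it is one of 0, 1, 2, 3, as a generic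
  letter occurs only twice and 4 only once. If \<open>z = 0\<close>, the very first 0 is not in the copy, and only
  two 0s are left. If \<open>z = 1\<close>, then \<open>x\<close> and \<open>y\<close> both occur twice before the last 1, so both are 0. If
  \<open>z = 3\<close>, then \<open>y\<close> occurs twice and lies between the last two 3s, so it is 0, namely the second 0,
  as \<open>x\<close> precedes it; but only two 3s follow. Finally, if \<open>z = 2\<close>, then \<open>y\<close> stands
  between two 2s of the second half, so it is generic; then \<open>x\<close>, too, stands between two such 2s,
  since a generic letter precedes them, and is generic. But the generic letters form a mirror word,
  which does not contain \<open>xyxy\<close>.
\<close>

lemma avoids_seed: "\<not> has_abcacbc (seed m)"
proof
  assume "has_abcacbc (seed m)"
  then obtain x y z where dist: "distinct [x, y, z]"
    and sub: "subseq [x, y, z, x, z, y, z] (seed m)"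
    unfolding has_abcacbc_def by blast
  define U D where "U = up_part m" and "D = down_part m"
  have seed: "seed m = [0, 1, 2, 3, 1, 0] @ U @ D @ [3, 4, 0, 3]"
    by (simp add: seed_def U_def D_def)
  have U: "v \<notin> set U" if "v < 5" "v \<noteq> 1" for v
    using set_up_part[of m] that by (auto simp: U_def)
  have D: "v \<notin> set D" if "v < 5" "v \<noteq> 2" for v
    using set_down_part[of m] that by (auto simp: D_def)
  have ne: "x \<noteq> y" "x \<noteq> z" "y \<noteq> z" using dist by auto
  have z3: "3 \<le> count_list (seed m) z"
    using count_le_subseq[OF sub, of z] ne by simp
  have "z < 5"
  proof (rule ccontr)
    assume "\<not> z < 5"
    then have "count_list (seed m) z \<le> 2"
      using count_generic[of z m] by (simp add: seed U_def D_def)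
    with z3 show False by simp
  qed
  moreover have "z \<noteq> 4" using z3 U[of 4] D[of 4] by (auto simp: seed)
  ultimately consider "z = 0" | "z = 1" | "z = 2" | "z = 3" by linarith
  then show False
  proof cases
    case 1
    then have "subseq [x, y, z, x, z, y, z] ([1, 2, 3, 1, 0] @ U @ D @ [3, 4, 0, 3])"
      using sub ne by (simp add: seed)
    from count_le_subseq[OF this, of z] show False
      using 1 ne U[of 0] D[of 0] by simp
  next
    case 2
    have "subseq ([x, y, z, x, z, y] @ [z]) (([0, 1, 2, 3, 1, 0] @ U) @ D @ [3, 4, 0, 3])"
      using sub by (simp add: seed)
    then have *: "subseq ([x, y, z, x, z, y] @ [z]) ([0, 1, 2, 3, 1, 0] @ U)"
      by (rule subseq_snoc_append_notin) (use 2 D[of 1] in auto)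
    have only_0: "v = 0" if "2 \<le> count_list ([0, 1, 2, 3, 1, 0] @ U) v" "v \<noteq> 1" for v
    proof (rule ccontr)
      assume "v \<noteq> 0"
      then show False
        using that U[of v] count_generic(1)[of v m] by (cases "v < 5") (auto simp: U_def split: if_splits)
    qed
    have "count_list ([x, y, z, x, z, y] @ [z]) x = 2" "count_list ([x, y, z, x, z, y] @ [z]) y = 2"
      using ne by simp_all
    then have "x = 0" "y = 0"
      using only_0[of x] only_0[of y] count_le_subseq[OF *] ne 2 by metis+
    with ne show False by simp
  next
    case 3
    have "subseq ([x, y, z, x, z, y] @ [z]) (([0, 1, 2, 3, 1, 0] @ U @ D) @ [3, 4, 0, 3])"
      using sub by (simp add: seed)
    then have *: "subseq ([x, y, z, x, z, y] @ [z]) ([0, 1, 2, 3, 1, 0] @ U @ D)"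
      by (rule subseq_snoc_append_notin) (use 3 in auto)
    have "subseq [2, 2, y, 2] ([0, 1, 2, 3, 1, 0] @ U @ D)"
      using * 3 by (intro subseq_order.order_trans[OF _ *]) auto
    then have "subseq [2, y, 2] (([3, 1, 0] @ U) @ D)" by simp
    then have "subseq [2, y, 2] D"
      by (rule subseq_Cons_append_notin) (use U[of 2] in auto)
    then have "y \<in> set D" by (rule subseq_in_set) simp
    then have y: "5 \<le> y" using D[of y] ne 3 by (meson not_less)
    have "subseq [y, 2, x, 2] ([0, 1, 2, 3, 1, 0] @ U @ D)"
      using 3 by (intro subseq_order.order_trans[OF _ *]) auto
    then have "subseq [y, 2, x, 2] (U @ D)"
      by (rule subseq_Cons_append_notin) (use y in auto)
    then have "subseq [2, x, 2] (U @ D)"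
      by (rule subseq_order.order_trans[rotated]) auto
    then have "subseq [2, x, 2] D"
      by (rule subseq_Cons_append_notin) (use U[of 2] in auto)
    then have "x \<in> set D" by (rule subseq_in_set) simp
    then have x: "5 \<le> x" using D[of x] ne 3 by (meson not_less)
    have "subseq (filter (\<lambda>v. 5 \<le> v) [x, y, z, x, z, y, z]) (filter (\<lambda>v. 5 \<le> v) (seed m))"
      using sub by (rule subseq_filter)
    then have "subseq [x, y, x, y] ([5..<2 * m + 5] @ rev [5..<2 * m + 5])"
      unfolding filter_ge_5_seed using x y 3 by simp
    with ne show False using not_subseq_abab_mirror[OF distinct_upt] by blast
  next
    case 4
    have "subseq [3, 3, y, 3] ([0, 1, 2, 3, 1, 0] @ U @ D @ [3, 4, 0, 3])"
      using 4 sub unfolding seed by (intro subseq_order.order_trans[OF _ sub[unfolded seed]]) auto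
    then have "subseq [3, y, 3] (([1, 0] @ U @ D) @ [3, 4, 0, 3])" by simp
    then have "subseq [3, y, 3] [3::nat, 4, 0, 3]"
      by (rule subseq_Cons_append_notin) (use U[of 3] D[of 3] in auto)
    then have "y = 4 \<or> y = 0" using 4 ne by (auto split: if_splits)
    moreover have "y \<noteq> 4"
    proof
      assume "y = 4"
      then have "count_list (seed m) y = 1" using U[of 4] D[of 4] by (simp add: seed)
      then show False using count_le_subseq[OF sub, of y] ne by simp
    qed
    ultimately have "y = 0" by simp
    then have *: "subseq [x, 0, 3, x, 3, 0, 3] ([1, 2, 3, 1, 0] @ U @ D @ [3, 4, 0, 3])"
      using sub 4 ne by (simp add: seed)
    have "subseq [0, 3, 3, 0, 3] ([1, 2, 3, 1, 0] @ U @ D @ [3, 4, 0, 3])"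
      by (rule subseq_order.order_trans[OF _ *]) auto
    then have "subseq [3, 3, 0, 3] ((U @ D) @ [3, 4, 0, 3])" by simp
    then have "subseq [3, 3, 0, 3] [3::nat, 4, 0, 3]"
      by (rule subseq_Cons_append_notin) (use U[of 3] D[of 3] in auto)
    then show False by simp
  qed
qed

section \<open>Insertions into the seed\<close>

lemma append_split_cases:
  assumes "as @ bs = xs @ ys"
  obtains (left) us where "as = xs @ us" "us \<noteq> []" "ys = us @ bs"
    | (right) us where "xs = as @ us" "bs = us @ ys"
  using assms unfolding append_eq_append_conv2 by (metis append_Nil append_Nil2)

text \<open>
  A gap between two blocks is assigned to the later one; so the block part after the gap is nonempty and
  contains the letter that ends the block.
\<close>

lemma concat_split_cases:
  assumes "concat bs = xs @ ys" and "ys \<noteq> []"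
  obtains bs1 b1 b2 bs2 where "bs = bs1 @ (b1 @ b2) # bs2" "b2 \<noteq> []"
    "xs = concat bs1 @ b1" "ys = b2 @ concat bs2"
  using assms
proof (induction bs arbitrary: xs thesis)
  case (Cons b bs)
  from Cons.prems(2) have "b @ concat bs = xs @ ys" by simp
  then show ?case
  proof (cases rule: append_split_cases)
    case (left us)
    then show ?thesis using Cons.prems(1)[of "[]" xs us bs] by simp
  next
    case (right us)
    then obtain bs1 b1 b2 bs2 where "bs = bs1 @ (b1 @ b2) # bs2" "b2 \<noteq> []"
      "us = concat bs1 @ b1" "ys = b2 @ concat bs2"
      using Cons.IH Cons.prems(3) by blast
    then show ?thesis using Cons.prems(1)[of "b # bs1" b1 b2 bs2] right by simp
  qed
qed simp

lemma subseq_insert: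
  assumes "subseq v xs" and "subseq w ys"
  shows "subseq (v @ x # w) (xs @ x # ys)"
  using assms by (intro list_emb_append_mono) auto

text \<open>
  The five ways in which an inserted generic letter \<open>x\<close> completes a copy, ordered by the position of
  the gap. It plays \<open>a\<close> in the first, \<open>b\<close> in the second, and \<open>c\<close> in the others, where it
  becomes the first, second or third \<open>c\<close>.
\<close>

lemma has_abcacbc_insertI:
  fixes x :: nat
  assumes "5 \<le> x"
  shows has_abcacbc_insert_before_all:
      "subseq [0, 3, x, 3, 0, 3] ys \<Longrightarrow> has_abcacbc (xs @ x # ys)"
    and has_abcacbc_insert_after_0:
      "subseq [0] xs \<Longrightarrow> subseq [1, 0, 1, x, 1] ys \<Longrightarrow> has_abcacbc (xs @ x # ys)"
    and has_abcacbc_insert_before_both: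
      "subseq [1, 2] xs \<Longrightarrow> subseq [1, x, 2, x] ys \<Longrightarrow> has_abcacbc (xs @ x # ys)"
    and has_abcacbc_insert_between:
      "subseq [1, 2, x, 1] xs \<Longrightarrow> subseq [2, x] ys \<Longrightarrow> has_abcacbc (xs @ x # ys)"
    and has_abcacbc_insert_after_both:
      "subseq [1, 2, x, 1, x, 2] xs \<Longrightarrow> has_abcacbc (xs @ x # ys)"
proof -
  assume "subseq [0, 3, x, 3, 0, 3] ys"
  from subseq_insert[of "[]" xs _ ys x, OF list_emb_Nil this]
  show "has_abcacbc (xs @ x # ys)" using assms unfolding has_abcacbc_def
    by (intro exI[of _ x] exI[of _ 0] exI[of _ 3]) simp
next
  assume "subseq [0] xs" "subseq [1, 0, 1, x, 1] ys"
  from subseq_insert[OF this, of x]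
  show "has_abcacbc (xs @ x # ys)" using assms unfolding has_abcacbc_def
    by (intro exI[of _ 0] exI[of _ x] exI[of _ 1]) simp
next
  assume "subseq [1, 2] xs" "subseq [1, x, 2, x] ys"
  from subseq_insert[OF this, of x]
  show "has_abcacbc (xs @ x # ys)" using assms unfolding has_abcacbc_def
    by (intro exI[of _ 1] exI[of _ 2] exI[of _ x]) simp
next
  assume "subseq [1, 2, x, 1] xs" "subseq [2, x] ys"
  from subseq_insert[OF this, of x]
  show "has_abcacbc (xs @ x # ys)" using assms unfolding has_abcacbc_def
    by (intro exI[of _ 1] exI[of _ 2] exI[of _ x]) simp
next
  assume "subseq [1, 2, x, 1, x, 2] xs"
  from subseq_insert[of _ xs "[]" ys x, OF this list_emb_Nil]
  show "has_abcacbc (xs @ x # ys)" using assms unfolding has_abcacbc_def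
    by (intro exI[of _ 1] exI[of _ 2] exI[of _ x]) simp
qed

lemma subseq_concat_member: "b \<in> set bs \<Longrightarrow> subseq v b \<Longrightarrow> subseq v (concat bs)"
  by (induction bs) (auto intro: list_emb_append2 list_emb_prefix)

lemma subseq_blocks:
  assumes "x \<in> {2 * j + 5, 2 * j + 6}" and "j \<in> set js"
  shows "subseq [x, 1] (concat (map up_block js))"
    and "subseq [x, 2] (concat (map down_block js))"
proof -
  have "subseq [x, 1] (up_block j)" "subseq [x, 2] (down_block j)"
    using assms(1) by (auto simp: up_block_def down_block_def)
  moreover have "up_block j \<in> set (map up_block js)" "down_block j \<in> set (map down_block js)"
    using assms(2) by simp_all
  ultimately show "subseq [x, 1] (concat (map up_block js))"
    "subseq [x, 2] (concat (map down_block js))"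
    by (blast intro: subseq_concat_member)+
qed

lemma subseq_blocks_single:
  assumes "x \<in> {2 * j + 5, 2 * j + 6}" and "j \<in> set js"
  shows "subseq [x] (concat (map up_block js))"
    and "subseq [x] (concat (map down_block js))"
  using subseq_blocks[OF assms, THEN subseq_order.order_trans[rotated]] by auto

lemma map_eq_split_cases:
  assumes "concat (map f js) = xs @ ys" and "ys \<noteq> []"
  obtains js1 i js2 b1 b2 where "js = js1 @ i # js2" "f i = b1 @ b2" "b2 \<noteq> []"
    "xs = concat (map f js1) @ b1" "ys = b2 @ concat (map f js2)"
proof -
  obtain bs1 b1 b2 bs2 where *: "map f js = bs1 @ (b1 @ b2) # bs2" "b2 \<noteq> []"
    "xs = concat bs1 @ b1" "ys = b2 @ concat bs2"
    using assms by (rule concat_split_cases)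
  obtain js1 i js2 where "js = js1 @ i # js2" "bs1 = map f js1" "f i = b1 @ b2" "bs2 = map f js2"
    using *(1) by (auto simp: map_eq_append_conv map_eq_Cons_conv)
  with * show thesis using that by blast
qed

text \<open>
  The exceptional pair \<open>i\<close> is the one whose block contains the gap: an insertion next to the old \<open>x\<close>
  may lack the separating 1 or 2 between the two. In the first part the pair 0 is exceptional,
  since no 1 precedes it in the upward half.
\<close>

lemma seed_insertion:
  assumes "seed m = xs @ ys"
  shows "\<exists>i. \<forall>j<m. j \<noteq> i \<longrightarrow> (\<forall>x\<in>{2 * j + 5, 2 * j + 6}. has_abcacbc (xs @ x # ys))"
proof -
  define F E :: "nat list" where "F = [0, 1, 2, 3, 1, 0]" and "E = [3, 4, 0, 3]"
  define U D where "U = up_part m" and "D = concat (map down_block (rev [0..<m]))"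
  have F12: "subseq [1, 2] F" by (simp add: F_def)
  have U1: "subseq [x, 1] U" and D1: "subseq [x, 2] D"
    if "j < m" "x \<in> {2 * j + 5, 2 * j + 6}" for j x
    using that subseq_blocks[of x j "[0..<m]"] subseq_blocks[of x j "rev [0..<m]"]
    by (auto simp: U_def D_def up_part_def)
  have D0: "subseq [x] D"
    if "j < m" "x \<in> {2 * j + 5, 2 * j + 6}" for j x
    using that subseq_blocks_single[of x j "rev [0..<m]"] by (auto simp: D_def)
  from assms have "F @ (U @ 2 # D @ E) = xs @ ys"
    by (simp add: seed_def F_def U_def D_def E_def down_part_def)
  then show ?thesis
  proof (cases rule: append_split_cases)
    case (left us)
    have "has_abcacbc (xs @ x # ys)" if x: "j < m" "x \<in> {2 * j + 5, 2 * j + 6}" and "j \<noteq> 0" for j x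
    proof -
      have x5: "5 \<le> x" using x by auto
      have "[0..<m] = 0 # [1..<m]" using x by (simp add: upt_conv_Cons)
      then have U: "U = [5, 6, 1] @ concat (map up_block [1..<m])"
        by (simp add: U_def up_part_def up_block_def)
      have *: "subseq [x, 1] (concat (map up_block [1..<m]))"
        using subseq_blocks(1)[of x j "[1..<m]"] x \<open>j \<noteq> 0\<close> by auto
      have "subseq ([1] @ [x, 1]) ([5, 6, 1] @ concat (map up_block [1..<m]))"
        using * by (intro list_emb_append_mono) auto
      then have U1x: "subseq [1, x, 1] U" unfolding U by simp
      have U1: "subseq [1, x] U"
        by (rule subseq_order.order_trans[OF _ U1x]) simp
      have D2: "subseq [2, x] (2 # D @ E)"
        using D0[OF x] by (simp add: list_emb_prefix)
      have UD: "subseq [1, x, 2, x] (U @ 2 # D @ E)"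
        using list_emb_append_mono[OF U1 D2] by simp
      have UE: "subseq [x, 3, 0, 3] (U @ 2 # D @ E)"
      proof -
        have "subseq [x] U" by (rule subseq_order.order_trans[OF _ U1x]) simp
        moreover have "subseq [3, 0, 3] (2 # D @ E)"
          by (intro list_emb_Cons list_emb_append2) (simp add: E_def)
        ultimately have "subseq ([x] @ [3, 0, 3]) (U @ 2 # D @ E)" by (rule list_emb_append_mono)
        then show ?thesis by simp
      qed
      consider "xs = []" | "xs = [0] \<or> xs = [0, 1]" | "subseq [1, 2] xs"
        using left(1,2) by (auto simp: F_def append_eq_Cons_conv Cons_eq_append_conv)
      then show ?thesis
      proof cases
        case 1
        then have "ys = F @ U @ 2 # D @ E" using left by simp
        then have "subseq [0, 3, x, 3, 0, 3] ys"
          using list_emb_append_mono[of "(=)" "[0, 3]" F, OF _ UE] by (simp add: F_def)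
        with x5 show ?thesis by (rule has_abcacbc_insert_before_all)
      next
        case 2
        then have "subseq [1, 0] us" using left by (auto simp: F_def)
        moreover have "subseq [1, x, 1] (U @ 2 # D @ E)" using U1x by (simp add: list_emb_prefix)
        ultimately have "subseq ([1, 0] @ [1, x, 1]) ys"
          unfolding left(3) by (rule list_emb_append_mono)
        with x5 2 show ?thesis by (intro has_abcacbc_insert_after_0) auto
      next
        case 3
        have "subseq [1, x, 2, x] ys" unfolding left(3) by (rule list_emb_append2[OF UD])
        with x5 3 show ?thesis by (intro has_abcacbc_insert_before_both)
      qed
    qed
    then show ?thesis by blast
  next
    case (right vs)
    from right(2) show ?thesis
    proof (cases rule: append_split_cases)
      case (left us)
      obtain js1 i js2 b1 b2 where
        js: "[0..<m] = js1 @ i # js2" and b: "up_block i = b1 @ b2" "b2 \<noteq> []"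
        and vs: "vs = concat (map up_block js1) @ b1" and us: "us = b2 @ concat (map up_block js2)"
        using left(1,2) unfolding U_def up_part_def by (rule map_eq_split_cases)
      have "last b2 = 1" using b by (metis up_block_def last.simps last_appendR list.discI)
      then have b2: "subseq [1] b2" using b(2) by (metis last_in_set subseq_singleton_left)
      have "has_abcacbc (xs @ x # ys)" if x: "j < m" "x \<in> {2 * j + 5, 2 * j + 6}" and "j \<noteq> i" for j x
      proof -
        have x5: "5 \<le> x" using x by auto
        have D2: "subseq [2, x] (2 # D @ E)"
          using D0[OF x] by (simp add: list_emb_prefix)
        have "j \<in> set (js1 @ i # js2)" unfolding js[symmetric] using x by simp
        then consider "j \<in> set js1" | "j \<in> set js2" using \<open>j \<noteq> i\<close> by auto
        then show ?thesis
        proof cases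
          case 1
          have "subseq [x, 1] vs"
            unfolding vs using subseq_blocks(1)[OF x(2) 1] by (rule list_emb_prefix)
          then have "subseq ([1, 2] @ [x, 1]) xs"
            unfolding right(1) using F12 by (intro list_emb_append_mono)
          moreover have "subseq [2, x] ys" unfolding left(3) using D2 by (rule list_emb_append2)
          ultimately show ?thesis using x5 by (intro has_abcacbc_insert_between) auto
        next
          case 2
          \<comment> \<open>The gap lies before the final 1 of its block, which separates the inserted letter from the
            next \<open>x\<close>.\<close>
          have "subseq ([1] @ [x]) us"
            unfolding us using b2 subseq_blocks_single(1)[OF x(2) 2] by (rule list_emb_append_mono)
          then have "subseq (([1] @ [x]) @ [2, x]) ys"
            unfolding left(3) using D2 by (rule list_emb_append_mono)
          moreover have "subseq [1, 2] xs" unfolding right(1) using F12 by (rule list_emb_prefix)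
          ultimately show ?thesis using x5 by (intro has_abcacbc_insert_before_both) auto
        qed
      qed
      then show ?thesis by blast
    next
      case U: (right ws)
      have xsU: "subseq [1, 2, x, 1] xs" if x: "j < m" "x \<in> {2 * j + 5, 2 * j + 6}" for j x
      proof -
        have "subseq [x, 1] vs" unfolding U(1) using U1[OF x] by (rule list_emb_prefix)
        then have "subseq ([1, 2] @ [x, 1]) xs"
          unfolding right(1) using F12 by (intro list_emb_append_mono)
        then show ?thesis by simp
      qed
      from U(2) have "[2] @ (D @ E) = ws @ ys" by simp
      then show ?thesis
      proof (cases rule: append_split_cases)
        case (left us)
        then have ys: "ys = 2 # D @ E" by (auto simp: Cons_eq_append_conv)
        have "has_abcacbc (xs @ x # ys)" if x: "j < m" "x \<in> {2 * j + 5, 2 * j + 6}" for j x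
          using xsU[OF x] D0[OF x] x
          by (intro has_abcacbc_insert_between) (auto simp: ys list_emb_prefix)
        then show ?thesis by blast
      next
        case two: (right ws')
        from two(2) show ?thesis
        proof (cases rule: append_split_cases)
          case (left us)
          obtain js1 i js2 b1 b2 where
            js: "rev [0..<m] = js1 @ i # js2" and b: "down_block i = b1 @ b2" "b2 \<noteq> []"
            and ws': "ws' = concat (map down_block js1) @ b1"
            and us: "us = b2 @ concat (map down_block js2)"
            using left(1,2) unfolding D_def by (rule map_eq_split_cases)
          have "last b2 = 2" using b by (metis down_block_def last.simps last_appendR list.discI)
          then have b2: "subseq [2] b2" using b(2) by (metis last_in_set subseq_singleton_left)
          have "has_abcacbc (xs @ x # ys)"
            if x: "j < m" "x \<in> {2 * j + 5, 2 * j + 6}" and "j \<noteq> i" for j x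
          proof -
            have x5: "5 \<le> x" using x by auto
            have "j \<in> set (rev [0..<m])" using x by simp
            then have "j \<in> set (js1 @ i # js2)" unfolding js .
            then consider "j \<in> set js1" | "j \<in> set js2" using \<open>j \<noteq> i\<close> by auto
            then show ?thesis
            proof cases
              case 1
              have *: "subseq [x, 2] ws'"
                unfolding ws' using subseq_blocks(2)[OF x(2) 1] by (rule list_emb_prefix)
              have "subseq ([x, 1] @ [x, 2]) (U @ 2 # ws')"
                by (rule list_emb_append_mono[OF U1[OF x] list_emb_Cons[OF *]])
              from list_emb_append_mono[OF F12 this] have "subseq ([1, 2] @ [x, 1] @ [x, 2]) xs"
                by (simp add: right(1) U(1) two(1))
              then show ?thesis using x5 by (intro has_abcacbc_insert_after_both) auto
            next
              case 2
              have "subseq ([2] @ [x]) us"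
                unfolding us using b2 subseq_blocks_single(2)[OF x(2) 2] by (rule list_emb_append_mono)
              then have "subseq [2, x] ys" unfolding left(3) by (simp add: list_emb_prefix)
              then show ?thesis using x5 xsU[OF x] by (intro has_abcacbc_insert_between)
            qed
          qed
          then show ?thesis by blast
        next
          case D: (right ws'')
          have "has_abcacbc (xs @ x # ys)" if x: "j < m" "x \<in> {2 * j + 5, 2 * j + 6}" for j x
          proof -
            have "subseq [x, 2] (2 # ws')"
              unfolding D(1) using D1[OF x] by (intro list_emb_Cons list_emb_prefix)
            then have "subseq ([x, 1] @ [x, 2]) (U @ 2 # ws')"
              using U1[OF x] by (intro list_emb_append_mono)
            from list_emb_append_mono[OF F12 this] have "subseq ([1, 2] @ [x, 1] @ [x, 2]) xs"
              by (simp add: right(1) U(1) two(1))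
            then show ?thesis using x by (intro has_abcacbc_insert_after_both) auto
          qed
          then show ?thesis by blast
        qed
      qed
    qed
  qed
qed

theorem proposition2:
  fixes a b c :: 'a
  assumes "distinct [a, b, c]"
  shows "(\<lambda>n. real (Sat n [a, b, c, a, c, b, c])) \<in> O(\<lambda>n. real n)"
proof -
  define u where "u = [a, b, c, a, c, b, c]"
  have u: "card (set u) = 3" "length u = 7"
  proof -
    have "set u = {a, b, c}" by (auto simp: u_def)
    then show "card (set u) = 3" using assms by simp
  qed (simp add: u_def)
  define C :: nat where "C = Suc (8 ^ 3 * 7) * 3"
  have bound: "Sat n u \<le> (20 + 20 * C) * n" if "5 \<le> n" for n
  proof -
    \<comment> \<open>If \<open>n\<close> is even, the letter \<open>2 * m + 5\<close> is left over. It may be inserted anywhere and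
      counts as one of the eight exceptions, with the special letters and one pair.\<close>
    define m where "m = (n - 5) div 2"
    have nm: "2 * m + 5 \<le> n" "n \<le> 2 * m + 6" using that by (auto simp: m_def)
    have "set (seed m) \<subseteq> {..<n}"
      using set_up_part[of m] set_down_part[of m] nm by (fastforce simp: seed_def)
    moreover have "avoids (seed m) u"
      using avoids_seed[of m] by (simp add: avoids_def u_def contains_copy_abcacbc_iff[OF assms])
    moreover have "card {x \<in> {..<n}. \<not> contains_copy (xs @ x # ys) u} \<le> 8"
      if split: "seed m = xs @ ys" for xs ys
    proof -
      obtain i where i: "\<And>j x. j < m \<Longrightarrow> j \<noteq> i \<Longrightarrow> x \<in> {2 * j + 5, 2 * j + 6} \<Longrightarrow>
          has_abcacbc (xs @ x # ys)"
        using seed_insertion[OF split] by blast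
      have "{x \<in> {..<n}. \<not> contains_copy (xs @ x # ys) u} \<subseteq>
          {0, 1, 2, 3, 4, 2 * i + 5, 2 * i + 6, 2 * m + 5}"
      proof (rule ccontr)
        assume "\<not> ?thesis"
        then obtain x where x: "x < n" "\<not> has_abcacbc (xs @ x # ys)"
          "x \<notin> {0, 1, 2, 3, 4, 2 * i + 5, 2 * i + 6, 2 * m + 5}"
          by (auto simp: u_def contains_copy_abcacbc_iff[OF assms])
        define j where "j = (x - 5) div 2"
        have "5 \<le> x" using x(3) by auto
        then have j: "x \<in> {2 * j + 5, 2 * j + 6}" unfolding j_def by auto
        with x nm have "j < m" "j \<noteq> i" by auto
        with i j x(2) show False by blast
      qed
      then have "card {x \<in> {..<n}. \<not> contains_copy (xs @ x # ys) u} \<le>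
          card {0, 1, 2, 3, 4, 2 * i + 5, 2 * i + 6, 2 * m + 5}"
        by (intro card_mono) auto
      also have "\<dots> \<le> length [0, 1, 2, 3, 4, 2 * i + 5, 2 * i + 6, 2 * m + 5]"
        using card_length[of "[0, 1, 2, 3, 4, 2 * i + 5, 2 * i + 6, 2 * m + 5]"] by simp
      finally show ?thesis by simp
    qed
    ultimately obtain s where s: "saturated {..<n} u s"
      "length s \<le> length (seed m) + Suc (length (seed m)) * C"
      using saturated_from_seed[of "{..<n}" "seed m" u 8] sparse_seed[of m]
      unfolding u C_def by auto
    have "Sat n u \<le> length s"
      unfolding Sat_def using s(1) by (intro Least_le exI[of _ "{..<n}"]) auto
    also note s(2)
    also have "length (seed m) + Suc (length (seed m)) * C \<le> 20 * n + (20 * n) * C"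
      using that nm by (intro add_mono mult_le_mono1) (auto simp: length_seed)
    finally show ?thesis by (simp add: algebra_simps)
  qed
  show ?thesis
    unfolding u_def[symmetric]
  proof (rule bigoI)
    show "\<forall>\<^sub>F n in at_top. norm (real (Sat n u)) \<le> real (20 + 20 * C) * norm (real n)"
      using eventually_ge_at_top[of 5]
    proof eventually_elim
      case (elim n)
      from bound[OF this] have "real (Sat n u) \<le> real ((20 + 20 * C) * n)"
        by (rule of_nat_mono)
      then show ?case by simp
    qed
  qed
qed

end
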